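(* For a positive integer $n$ let $\Delta_{T_n}(t)=nt^2-(2n+1)t+n$ be the Alexander polynomial of the $n$-twist knot $T_n$. If $n$ is not a perfect power and $n$ is not of the form $y(y+1)$ with $y\in\mathbb{Z}$, then $\Delta_{T_n}$ is strongly irreducible. If $n$ is a perfect square, then $\Delta_{T_n}$ is not strongly irreducible.
   Context: A polynomial $f\in\mathbb{Q}[t]$ is strongly irreducible if $f(t^k)$ is irreducible in $\mathbb{Q}[t]$ for every positive integer $k$. A positive integer is a perfect power if it equals $\alpha^k$ for some integer $\alpha\ge 1$ and some integer $k>1$ (in particular $1$ is a perfect power). *)

theory Defs
  imports "HOL-Computational_Algebra.Computational_Algebra"
begin

definition strongly_irreducible :: "rat poly \<Rightarrow> bool" where
  "strongly_irreducible f \<longleftrightarrow> (\<forall>k::nat. k > 0 \<longrightarrow> irreducible (pcompose f (monom 1 k)))"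

definition perfect_power :: "nat \<Rightarrow> bool" where
  "perfect_power n \<longleftrightarrow> (\<exists>a k::nat. a \<ge> 1 \<and> k > 1 \<and> n = a ^ k)"

(* The Alexander polynomial n t^2 - (2n+1) t + n of the n-twist knot. *)
definition twist_knot_Alexander_poly :: "nat \<Rightarrow> rat poly" where
  "twist_knot_Alexander_poly n = [:of_nat n, - (2 * of_nat n + 1), of_nat n:]"

end

theory Submission
  imports Defs "Jordan_Normal_Form.Determinant" "Berlekamp_Zassenhaus.Factor_Bound"
begin

text \<open>Let \<open>F\<close> be irreducible over the integers and \<open>F(x^k) = g h\<close>. Taking norms from \<open>\<int>[x]\<close> down to
  \<open>\<int>[t]\<close>, \<open>t = x^k\<close>, gives \<open>N(g) N(h) = F^k\<close>, so \<open>N(g) = \<plusminus>F^d\<close> for some \<open>d \<le> k\<close>. The constant coefficient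
  of \<open>N(g)\<close> is \<open>g(0)^k\<close>, whence \<open>\<bar>g(0)\<bar>^k = \<bar>F(0)\<bar>^d\<close>. If \<open>\<bar>F(0)\<bar>\<close> is not a perfect power, this forces
  \<open>d = 0\<close> or \<open>d = k\<close>, so \<open>N(g)\<close> or \<open>N(h)\<close> is a unit, and then so is \<open>g\<close> or \<open>h\<close>. The quadratic
  \<open>n t^2 - (2n+1) t + n\<close> has discriminant \<open>4n+1\<close>, which is a square iff \<open>n = y(y+1)\<close>. Conversely, for
  \<open>n = m^2\<close> the value at \<open>t^2\<close> is \<open>(m t^2 - m)^2 - t^2\<close>, a difference of squares.\<close>

hide_const (open) up_ring.coeff up_ring.monom

section \<open>Sections of a polynomial and the norm from \<open>R[x]\<close> to
  \<open>R[x^k]\<close>\<close>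

text \<open>The coordinate of \<open>p\<close> at the basis element \<open>x^j\<close> of
  \<open>R[x]\<close> over \<open>R[t]\<close>, \<open>t = x^k\<close>. Stopping at
  \<open>degree p\<close> loses nothing for \<open>k > 0\<close>, as then
  \<open>m \<le> k * m + j\<close>.\<close>

definition poly_section :: "nat \<Rightarrow> nat \<Rightarrow> 'a::comm_monoid_add poly \<Rightarrow> 'a poly" where
  "poly_section k j p = (\<Sum>m\<le>degree p. monom (coeff p (k * m + j)) m)"

lemma coeff_poly_section:
  assumes "k > 0"
  shows "coeff (poly_section k j p) m = coeff p (k * m + j)"
proof -
  have "m \<le> degree p" if "coeff p (k * m + j) \<noteq> 0"
  proof -
    have "m \<le> k * m" using assms by (cases k) auto
    with le_degree[OF that] show ?thesis by linarith
  qed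
  then show ?thesis
    by (auto simp: poly_section_def coeff_sum coeff_monom if_distrib sum.delta cong: if_cong)
qed

lemma poly_section_sum:
  assumes "k > 0"
  shows "poly_section k j (\<Sum>i\<in>I. f i) = (\<Sum>i\<in>I. poly_section k j (f i))"
  using assms by (intro poly_eqI) (simp add: coeff_poly_section coeff_sum)

text \<open>Linearity over \<open>R[t]\<close>: a factor \<open>x^k\<close> keeps exponents in their
  class modulo \<open>k\<close>.\<close>

lemma poly_section_pcompose_mult:
  fixes p q :: "'a::comm_ring_1 poly"
  assumes j: "j < k"
  shows "poly_section k j (pcompose q (monom 1 k) * p) = q * poly_section k j p"
proof (induction q)
  case 0
  show ?case using j by (intro poly_eqI) (simp add: coeff_poly_section)
next
  case (pCons a q)
  have "poly_section k j (pcompose (pCons a q) (monom 1 k) * p)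
      = poly_section k j (Polynomial.smult a p + monom 1 k * (pcompose q (monom 1 k) * p))"
    by (simp add: pcompose_pCons algebra_simps)
  also have "\<dots> = Polynomial.smult a (poly_section k j p)
      + pCons 0 (poly_section k j (pcompose q (monom 1 k) * p))"
    using j by (intro poly_eqI)
      (auto simp: coeff_poly_section coeff_monom_mult coeff_pCons split: nat.split)
  also have "\<dots> = pCons a q * poly_section k j p"
    by (simp add: pCons.IH)
  finally show ?case .
qed

lemma poly_section_decomp:
  fixes p :: "'a::comm_ring_1 poly"
  assumes k: "k > 0"
  shows "(\<Sum>j<k. pcompose (poly_section k j p) (monom 1 k) * monom 1 j) = p"
proof (rule poly_eqI)
  fix n
  define q r where "q = n div k" and "r = n mod k"
  have n: "n = k * q + r" and r: "r < k" using k by (auto simp: q_def r_def)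
  \<comment> \<open>The \<open>j\<close>-th summand lives on exponents congruent to \<open>j\<close>
    modulo \<open>k\<close>, so only \<open>j = r\<close> reaches the exponent
    \<open>n\<close>.\<close>
  have "coeff (pcompose (poly_section k j p) (monom 1 k) * monom 1 j) n
      = (if j = r then coeff p n else 0)" if j: "j < k" for j
  proof (cases "j \<le> n")
    case True
    define q' r' where "q' = (n - j) div k" and "r' = (n - j) mod k"
    have n': "n - j = k * q' + r'" and r': "r' < k" using k by (auto simp: q'_def r'_def)
    have "r' = 0 \<longleftrightarrow> j = r"
    proof
      assume "r' = 0"
      with n' True have "n = k * q' + j" by simp
      then show "j = r" using j by (simp add: r_def)
    next
      assume "j = r"
      with n have "n - j = k * q" by simp
      then show "r' = 0" by (simp add: r'_def)
    qed
    moreover have "n = k * q' + j" if "r' = 0" using n' True that by simp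
    ultimately show ?thesis using True k
      by (auto simp: mult.commute[of _ "monom 1 j"] coeff_monom_mult n'
          coeff_pcompose_monom[OF r'] coeff_poly_section)
  next
    case False
    then have "j \<noteq> r" using n by auto
    with False show ?thesis by (simp add: mult.commute[of _ "monom 1 j"] coeff_monom_mult)
  qed
  then show "coeff (\<Sum>j<k. pcompose (poly_section k j p) (monom 1 k) * monom 1 j) n = coeff p n"
    using r by (simp add: coeff_sum)
qed

text \<open>\<open>section_mat k g\<close> is the matrix of multiplication by \<open>g\<close> on \<open>R[x]\<close>, seen as a free module
  over \<open>R[t]\<close> (with \<open>t\<close> acting as \<open>x^k\<close>) with basis \<open>1, x, \<dots>, x^(k-1)\<close>; its determinant is
  therefore the norm of \<open>g\<close>.\<close>

definition section_mat :: "nat \<Rightarrow> 'a::comm_ring_1 poly \<Rightarrow> 'a poly mat" where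
  "section_mat k g = mat k k (\<lambda>(i, j). poly_section k j (monom 1 i * g))"

definition section_norm :: "nat \<Rightarrow> 'a::comm_ring_1 poly \<Rightarrow> 'a poly" where
  "section_norm k g = det (section_mat k g)"

lemma section_mat_carrier [simp]: "section_mat k g \<in> carrier_mat k k"
  by (simp add: section_mat_def)

text \<open>Row \<open>i\<close> holds the coordinates of \<open>x^i * g\<close>; expanding
  \<open>x^i * g\<close> in the basis and multiplying by \<open>h\<close> gives the matrix
  product.\<close>

lemma section_mat_mult:
  "section_mat k (g * h) = section_mat k g * section_mat k h"
proof (rule eq_matI)
  fix i j assume "i < dim_row (section_mat k g * section_mat k h)"
    and "j < dim_col (section_mat k g * section_mat k h)"
  then have i: "i < k" and j: "j < k" by (simp_all add: section_mat_def)
  then have k: "k > 0" by simp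
  have "poly_section k j (monom 1 i * (g * h)) = poly_section k j
      (\<Sum>l<k. pcompose (poly_section k l (monom 1 i * g)) (monom 1 k) * (monom 1 l * h))"
    using poly_section_decomp[OF k, of "monom 1 i * g"]
    by (simp flip: mult.assoc sum_distrib_right)
  also have "\<dots> = (\<Sum>l<k. poly_section k l (monom 1 i * g) * poly_section k j (monom 1 l * h))"
    by (simp add: poly_section_sum[OF k] poly_section_pcompose_mult[OF j])
  finally show "section_mat k (g * h) $$ (i, j) = (section_mat k g * section_mat k h) $$ (i, j)"
    using i j by (simp add: section_mat_def scalar_prod_def atLeast0LessThan)
qed (simp_all add: section_mat_def)

lemma section_norm_mult:
  "section_norm k (g * h) = section_norm k g * section_norm k h"
  unfolding section_norm_def section_mat_mult by (rule det_mult[of _ k]) simp_all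

text \<open>Multiplication by an element of the base ring \<open>R[t]\<close> is a scalar
  matrix.\<close>

lemma section_norm_pcompose:
  fixes f :: "'a::comm_ring_1 poly"
  shows "section_norm k (pcompose f (monom 1 k)) = f ^ k"
proof -
  have "section_mat k (pcompose f (monom 1 k)) = f \<cdot>\<^sub>m 1\<^sub>m k"
  proof (rule eq_matI)
    fix i j assume "i < dim_row (f \<cdot>\<^sub>m 1\<^sub>m k)" "j < dim_col (f \<cdot>\<^sub>m 1\<^sub>m k)"
    then have i: "i < k" and j: "j < k" by simp_all
    have "poly_section k j (monom 1 i) = (if i = j then 1 else 0 :: 'a poly)"
    proof (rule poly_eqI)
      fix m
      have "i = k * m + j \<longleftrightarrow> m = 0 \<and> i = j"
        using i by (cases m) auto
      then show "coeff (poly_section k j (monom 1 i)) m = coeff (if i = j then 1 else 0 :: 'a poly) m"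
        using i by (auto simp: coeff_poly_section coeff_monom)
    qed
    then show "section_mat k (pcompose f (monom 1 k)) $$ (i, j) = (f \<cdot>\<^sub>m 1\<^sub>m k) $$ (i, j)"
      using i j poly_section_pcompose_mult[OF j, of f "monom 1 i"]
      by (simp add: section_mat_def mult.commute)
  qed (simp_all add: section_mat_def)
  then show ?thesis by (simp add: section_norm_def det_smult)
qed

text \<open>Since \<open>x^i * g\<close> has no exponent below \<open>i\<close>, the matrix at
  \<open>t = 0\<close> is upper triangular with \<open>g(0)\<close> along the diagonal.\<close>

lemma coeff_0_section_norm:
  fixes g :: "'a::comm_ring_1 poly"
  shows "coeff (section_norm k g) 0 = coeff g 0 ^ k"
proof -
  have ev: "comm_ring_hom (\<lambda>p::'a poly. poly p 0)"
    by unfold_locales auto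
  let ?A = "map_mat (\<lambda>p. poly p 0) (section_mat k g)"
  have entry: "?A $$ (i, j) = (if i \<le> j then coeff g (j - i) else 0)" if "i < k" "j < k" for i j
    using that by (auto simp: section_mat_def poly_0_coeff_0 coeff_poly_section coeff_monom_mult)
  have "coeff (section_norm k g) 0 = det ?A"
    by (simp add: section_norm_def comm_ring_hom.hom_det[OF ev] del: poly_0_coeff_0 flip: poly_0_coeff_0)
  also have "\<dots> = prod_list (diag_mat ?A)"
  proof (rule det_upper_triangular)
    have "dim_row ?A = k" by (simp add: section_mat_def)
    then show "upper_triangular ?A"
      unfolding upper_triangular_def using entry by auto
    show "?A \<in> carrier_mat k k" by simp
  qed
  also have "\<dots> = (\<Prod>i<k. ?A $$ (i, i))"
    by (simp add: prod_list_diag_prod section_mat_def atLeast0LessThan)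
  also have "\<dots> = coeff g 0 ^ k" by (simp add: entry)
  finally show ?thesis .
qed

text \<open>The vector \<open>(1, x, \<dots>, x^(k-1))\<close> is an eigenvector for \<open>g\<close> of \<open>section_mat k g\<close> at \<open>t = x^k\<close>;
  multiplying by the adjugate gives the divisibility.\<close>

lemma dvd_pcompose_section_norm:
  fixes g :: "'a::comm_ring_1 poly"
  assumes k: "k > 0"
  shows "g dvd pcompose (section_norm k g) (monom 1 k)"
proof -
  define B where "B = adj_mat (section_mat k g)"
  let ?s = "\<lambda>p :: 'a poly. pcompose p (monom 1 k)"
  have B: "B \<in> carrier_mat k k" "B * section_mat k g = section_norm k g \<cdot>\<^sub>m 1\<^sub>m k"
    unfolding B_def section_norm_def by (rule adj_mat[OF section_mat_carrier])+
  \<comment> \<open>Row 0 is chosen because the eigenvector has entry 1 there, so the norm itself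
    appears.\<close>
  have entry: "(\<Sum>i<k. B $$ (0, i) * section_mat k g $$ (i, j)) = (if j = 0 then section_norm k g else 0)"
    if "j < k" for j
  proof -
    have "(B * section_mat k g) $$ (0, j) = (\<Sum>i<k. B $$ (0, i) * section_mat k g $$ (i, j))"
      using B(1) that k by (simp add: scalar_prod_def atLeast0LessThan section_mat_def)
    then show ?thesis using that k by (auto simp: B(2))
  qed
  have "?s (section_norm k g) = (\<Sum>j<k. ?s (if j = 0 then section_norm k g else 0) * monom 1 j)"
    using k by (simp add: if_distrib[of ?s] if_distrib[of "\<lambda>p. p * _"] sum.delta monom_0 cong: if_cong)
  also have "\<dots> = (\<Sum>j<k. \<Sum>i<k. ?s (B $$ (0, i)) * (?s (section_mat k g $$ (i, j)) * monom 1 j))"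
    by (intro sum.cong refl)
      (simp flip: entry add: pcompose_sum pcompose_mult sum_distrib_right mult.assoc)
  also have "\<dots> = (\<Sum>i<k. ?s (B $$ (0, i)) * (\<Sum>j<k. ?s (section_mat k g $$ (i, j)) * monom 1 j))"
    by (subst sum.swap) (simp add: sum_distrib_left)
  also have "\<dots> = (\<Sum>i<k. ?s (B $$ (0, i)) * (monom 1 i * g))"
    by (intro sum.cong refl) (simp add: section_mat_def poly_section_decomp[OF k])
  also have "g dvd \<dots>" by (intro dvd_sum dvd_mult) simp
  finally show ?thesis .
qed

lemma is_unit_if_section_norm_is_unit:
  fixes g :: "'a::idom poly"
  assumes k: "k > 0" and unit: "section_norm k g dvd 1"
  shows "g dvd 1"
proof -
  from unit obtain c where c: "section_norm k g = [:c:]" "c dvd 1"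
    by (auto simp: is_unit_poly_iff)
  have "g dvd [:c:]" using dvd_pcompose_section_norm[OF k, of g] by (simp add: c)
  also have "[:c:] dvd 1" using c(2) by (auto simp: is_unit_poly_iff)
  finally show ?thesis .
qed

section \<open>Perfect powers and irreducibility of \<open>F(x^k)\<close> over the integers\<close>

text \<open>Cancelling \<open>gcd d k\<close> from the exponents leaves coprime \<open>d'\<close>
  and \<open>k' > 1\<close>; comparing multiplicities of each prime shows that \<open>n\<close> is a
  \<open>k'\<close>-th power.\<close>

lemma perfect_power_if_power_eq:
  assumes eq: "a ^ k = n ^ d" and d: "0 < d" "d < k" and n: "n > 0"
  shows "perfect_power n"
proof -
  define e where "e = gcd d k"
  have e: "e > 0" "e \<le> d" using d by (auto simp: e_def intro: dvd_imp_le)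
  obtain d' k' where d': "d = d' * e" and k': "k = k' * e"
    and cop: "algebraic_semidom_class.coprime d' k'"
    unfolding e_def using gcd_coprime_exists[of d k] d by auto
  \<comment> \<open>\<open>k' = 1\<close> would give \<open>k = e \<le> d\<close>.\<close>
  have "k' \<noteq> 0" "k' \<noteq> 1" using d(2) e k' by (auto intro: gr0I)
  then have k'_gt: "k' > 1" by simp
  have a: "a \<noteq> 0" using arg_cong[OF eq, of "\<lambda>x. x = 0"] n d by simp
  have "k' dvd multiplicity p n" if p: "prime p" for p
  proof -
    have "k * multiplicity p a = d * multiplicity p n"
      using arg_cong[OF eq, of "multiplicity p"] p n a
      by (simp add: prime_elem_multiplicity_power_distrib)
    then have "k dvd d * multiplicity p n" by (metis dvd_triv_left)
    then have "k' * e dvd d' * e * multiplicity p n" unfolding d' k' .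
    then have "k' dvd d' * multiplicity p n" using e(1) by (simp add: ac_simps)
    then show ?thesis using cop by (metis algebraic_semidom_class.coprime_commute coprime_dvd_mult_right_iff)
  qed
  then have "is_nth_power k' n"
    using k'_gt by (simp add: is_nth_power_conv_multiplicity_nat)
  then obtain b where "n = b ^ k'" by (auto simp: is_nth_power_def)
  with n k'_gt show ?thesis unfolding perfect_power_def
    by (intro exI[of _ b] exI[of _ k']) (auto simp: Suc_le_eq intro: gr0I)
qed

theorem irreducible_pcompose_monom:
  fixes F :: "int poly"
  assumes irr: "irreducible F" and F0: "coeff F 0 \<noteq> 0"
    and npp: "\<not> perfect_power (nat \<bar>coeff F 0\<bar>)" and k: "k > 0"
  shows "irreducible (pcompose F (monom 1 k))"
proof -
  let ?n = "nat \<bar>coeff F 0\<bar>"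
  have n: "?n > 0" using F0 by simp
  have coeff0: "coeff (pcompose F (monom 1 k)) 0 = coeff F 0"
    using coeff_pcompose_monom[of 0 k F 0] k by simp
  show ?thesis
  proof (rule irreducibleI)
    show "pcompose F (monom 1 k) \<noteq> 0" using coeff0 F0 by (metis coeff_0)
    show "\<not> pcompose F (monom 1 k) dvd 1"
    proof
      assume "pcompose F (monom 1 k) dvd 1"
      then obtain c where "pcompose F (monom 1 k) = [:c:]" "\<bar>c\<bar> = 1"
        by (auto simp: is_unit_poly_iff)
      \<comment> \<open>A unit would have constant term 1 or -1, and 1 counts as a perfect
        power.\<close>
      then have "?n = 1 ^ 2" using coeff0 by simp
      with npp show False unfolding perfect_power_def
        by (metis one_less_numeral_iff semiring_norm(76) order_refl)
    qed
  next
    fix g h assume gh: "pcompose F (monom 1 k) = g * h"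
    let ?G = "section_norm k g" and ?H = "section_norm k h"
    have GH: "?G * ?H = F ^ k"
      by (simp flip: section_norm_mult gh add: section_norm_pcompose)
    \<comment> \<open>\<open>prime\<close> demands a normalized element, so divisors of
      \<open>F ^ k\<close> are classified through \<open>normalize F\<close> and the result is
      carried back up to units.\<close>
    have "prime (normalize F)" using irr
      by (simp add: prime_def irreducible_imp_prime_poly)
    moreover have "F ^ k dvd normalize F ^ k" by (intro dvd_power_same) simp
    then have "?G dvd normalize F ^ k" using GH by (metis dvd_triv_left dvd_trans)
    ultimately obtain d where d: "d \<le> k" "normalize ?G = normalize (normalize F ^ d)"
      by (rule divides_primepow_weak)
    have "normalize F ^ d dvd F ^ d" "F ^ d dvd normalize F ^ d" by (intro dvd_power_same; simp)+
    moreover have "?G dvd normalize F ^ d" "normalize F ^ d dvd ?G"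
      using d(2) by (simp_all add: associated_iff_dvd)
    ultimately have assoc: "?G dvd F ^ d" "F ^ d dvd ?G" by (blast intro: dvd_trans)+
    have "coeff p 0 dvd coeff q 0" if "p dvd q" for p q :: "int poly"
      using that by (auto simp: coeff_mult_0 elim!: dvdE)
    then have "\<bar>coeff ?G 0\<bar> = \<bar>coeff (F ^ d) 0\<bar>"
      using assoc by (intro zdvd_antisym_abs)
    then have "\<bar>coeff g 0\<bar> ^ k = \<bar>coeff F 0\<bar> ^ d"
      by (simp add: coeff_0_section_norm coeff_0_power power_abs)
    then have "nat \<bar>coeff g 0\<bar> ^ k = ?n ^ d"
      by (simp flip: nat_power_eq)
    then have "\<not> (0 < d \<and> d < k)"
      using perfect_power_if_power_eq n npp by blast
    with d(1) consider "d = 0" | "d = k" by linarith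
    then show "g dvd 1 \<or> h dvd 1"
    proof cases
      case 1
      then have "?G dvd 1" using assoc by simp
      then show ?thesis using is_unit_if_section_norm_is_unit[OF k] by blast
    next
      case 2
      \<comment> \<open>Here the norm of \<open>g\<close> already absorbs all of
        \<open>F ^ k\<close>, so cancelling it leaves a unit for \<open>h\<close>.\<close>
      have "?G * ?H dvd ?G * 1" using assoc(2) 2 by (simp add: GH)
      moreover have "?G \<noteq> 0" using GH irr k by (auto simp: irreducible_def)
      ultimately have "?H dvd 1" by (simp only: dvd_mult_cancel_left) simp
      then show ?thesis using is_unit_if_section_norm_is_unit[OF k] by blast
    qed
  qed
qed

section \<open>Rational coefficients and the twist knot polynomials\<close>

text \<open>Gauss's lemma: a nonconstant irreducible integer polynomial is primitive.\<close>

lemma irreducible_of_int_poly: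
  fixes F :: "int poly"
  assumes "irreducible F" "degree F > 0"
  shows "irreducible (of_int_poly F :: rat poly)"
proof -
  have "content F = 1" using assms nonconst_poly_irreducible_iff[of F] by blast
  then have "primitive F" by simp
  then have "irreducible\<^sub>d F" using assms(1) by (rule iffD2[OF irreducible_primitive_connect])
  then have "irreducible\<^sub>d (of_int_poly F :: rat poly)" by (rule irreducible\<^sub>d_int_rat)
  then show ?thesis by (rule iffD1[OF irreducible_connect_field])
qed

text \<open>The value at 1 is -1, so a constant factor is a unit. Two linear factors would make the
  discriminant \<open>4 * m + 1\<close> an odd square \<open>(2 * y + 1)^2\<close>, whence
  \<open>m = y * (y + 1)\<close>.\<close>

lemma irreducible_twist_knot_int_poly:
  fixes m :: int
  assumes m: "m > 0" and not_form: "\<nexists>y. m = y * (y + 1)"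
  shows "irreducible [:m, - (2 * m + 1), m:]"
proof (rule irreducibleI)
  let ?f = "[:m, - (2 * m + 1), m:]"
  show "?f \<noteq> 0" using m by simp
  show "\<not> ?f dvd 1" using m by (auto simp: is_unit_poly_iff)
  fix g h assume gh: "?f = g * h"
  have nz: "g \<noteq> 0" "h \<noteq> 0" using gh m by auto
  then have deg: "degree g + degree h = 2"
    using arg_cong[OF gh, of degree] m by (simp add: degree_mult_eq)
  have "poly ?f 1 = -1" by simp
  then have val: "poly g 1 * poly h 1 = -1" unfolding gh by simp
  have const_unit: "p dvd 1" if "degree p = 0" "poly p 1 dvd 1" for p :: "int poly"
    using that by (elim degree_eq_zeroE) (auto simp: is_unit_poly_iff)
  have units: "poly g 1 dvd 1" "poly h 1 dvd 1"
    using val by (metis dvd_triv_left dvd_triv_right dvd_minus_iff)+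
  have "\<not> (degree g = 1 \<and> degree h = 1)"
  proof
    assume "degree g = 1 \<and> degree h = 1"
    then obtain a b c d where g: "g = [:a, b:]" and h: "h = [:c, d:]"
      by (metis degree1_coeffs)
    have eqs: "a * c = m" "a * d + b * c = - (2 * m + 1)" "b * d = m"
      using gh unfolding g h by (auto simp: algebra_simps)
    have "(a * d - b * c)\<^sup>2 = (a * d + b * c)\<^sup>2 - 4 * (a * c) * (b * d)"
      by (simp add: power2_eq_square algebra_simps)
    also have "\<dots> = 4 * m + 1" unfolding eqs by (simp add: power2_eq_square algebra_simps)
    finally have sq: "(a * d - b * c)\<^sup>2 = 4 * m + 1" .
    then have "odd ((a * d - b * c)\<^sup>2)" by simp
    then have "odd (a * d - b * c)" by simp
    then obtain y where "a * d - b * c = 2 * y + 1" by (elim oddE)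
    with sq have "m = y * (y + 1)" by (simp add: power2_eq_square algebra_simps)
    with not_form show False by blast
  qed
  with deg have "degree g = 0 \<or> degree h = 0" by linarith
  then show "g dvd 1 \<or> h dvd 1" using const_unit units by blast
qed

lemma twist_knot_Alexander_poly_of_int:
  "twist_knot_Alexander_poly n = of_int_poly [:int n, - (2 * int n + 1), int n:]"
  unfolding twist_knot_Alexander_poly_def of_int_hom.map_poly_pCons_hom by simp

lemma not_irreducible_twist_knot_square:
  assumes "m > 0"
  shows "\<not> irreducible (pcompose (twist_knot_Alexander_poly (m ^ 2)) (monom 1 2))"
proof
  let ?g = "[:- of_nat m, -1, of_nat m:] :: rat poly"
  let ?h = "[:- of_nat m, 1, of_nat m:] :: rat poly"
  assume "irreducible (pcompose (twist_knot_Alexander_poly (m ^ 2)) (monom 1 2))"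
  moreover have "pcompose (twist_knot_Alexander_poly (m ^ 2)) (monom 1 2) = ?g * ?h"
    by (simp add: twist_knot_Alexander_poly_def pcompose_pCons monom_altdef
        power2_eq_square algebra_simps)
  ultimately have "?g dvd 1 \<or> ?h dvd 1" by (rule irreducibleD)
  with assms show False by (auto simp: is_unit_poly_iff)
qed

theorem corollary4p5:
  fixes n :: nat
  assumes "n > 0"
  shows "(\<not> perfect_power n \<and> \<not> (\<exists>y::int. int n = y * (y + 1))
            \<longrightarrow> strongly_irreducible (twist_knot_Alexander_poly n)) \<and>
         (is_square n \<longrightarrow> \<not> strongly_irreducible (twist_knot_Alexander_poly n))"
proof (intro conjI impI)
  assume asm: "\<not> perfect_power n \<and> \<not> (\<exists>y::int. int n = y * (y + 1))"
  let ?F = "[:int n, - (2 * int n + 1), int n:]"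
  show "strongly_irreducible (twist_knot_Alexander_poly n)"
    unfolding strongly_irreducible_def
  proof (intro allI impI)
    fix k :: nat assume k: "k > 0"
    have "irreducible ?F" using asm assms by (intro irreducible_twist_knot_int_poly) auto
    then have "irreducible (pcompose ?F (monom 1 k))"
      using asm assms k by (intro irreducible_pcompose_monom) auto
    \<comment> \<open>Positive degree matters: a prime constant is irreducible over the integers but
      a unit over the rationals.\<close>
    moreover have "degree (pcompose ?F (monom 1 k)) > 0"
      using assms k by (simp add: degree_monom_eq del: pcompose_pCons)
    ultimately have "irreducible (of_int_poly (pcompose ?F (monom 1 k)) :: rat poly)"
      by (rule irreducible_of_int_poly)
    then show "irreducible (pcompose (twist_knot_Alexander_poly n) (monom 1 k))"
      by (simp only: twist_knot_Alexander_poly_of_int of_int_hom.map_poly_pcompose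
          of_int_hom.map_poly_hom_monom of_int_1)
  qed
next
  assume "is_square n"
  then obtain m where m: "n = m ^ 2" by (auto simp: is_nth_power_def)
  with assms have "m > 0" by (cases m) auto
  with m show "\<not> strongly_irreducible (twist_knot_Alexander_poly n)"
    unfolding strongly_irreducible_def using not_irreducible_twist_knot_square
    by (metis zero_less_numeral)
qed

end
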